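(* Let $c\ge 1$ and $n\ge 0$ be integers. There is an isomorphism of $\mathbb{C}$-algebras $$\mathbb{C}P_{n,c}\cong\bigoplus_{n_0+\cdots+n_c=n}\mathrm{Mat}\left(\binom{n}{n_0,\ldots,n_c},\binom{n}{n_0,\ldots,n_c}\right),$$ where the sum is over all tuples of non-negative integers $(n_0,\ldots,n_c)$ with sum $n$, and $\mathrm{Mat}(m,m)$ is the algebra of all $m\times m$ matrices with complex entries.
   Context: Fix colors $u_1,\ldots,u_c$. For $n\ge1$, $P_{n,c}$ is the set of diagrams consisting of a top row and a bottom row of $n$ vertices (each row numbered $1,\ldots,n$) together with edges, each joining a top vertex to a bottom vertex and colored with one of the $c$ colors, such that each vertex is incident to at most one edge and no two edges of the same color cross (if top $i$–bottom $j$ and top $i'$–bottom $j'$ are edges of the same color with $i<i'$, then $j<j'$). $P_{0,c}=\{\emptyset\}$ consists of the single empty diagram. The product $d_1d_2$ is obtained by stacking $d_1$ on top of $d_2$, identifying the bottom vertices of $d_1$ with the top vertices of $d_2$; the edges of $d_1d_2$ are exactly the monochromatic paths from the top of $d_1$ to the bottom of $d_2$ (with that color). This makes $P_{n,c}$ a semigroup. $\mathbb{C}P_{n,c}$ is the $\mathbb{C}$-algebra with basis $P_{n,c}$ and multiplication extended bilinearly; it is associative and unital. *)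

theory Defs
  imports "HOL-Algebra.QuotRing" "Jordan_Normal_Form.VS_Connect"
begin

section \<open>Algebras over the complex numbers\<close>

text \<open>The locale \<^locale>\<open>algebra\<close> of HOL-Algebra requires the multiplication to be commutative, so
  associative unital algebras that need not be commutative are introduced here.\<close>

definition complex_algebra :: "(complex, 'a) module \<Rightarrow> bool" where
  "complex_algebra A \<longleftrightarrow>
     ring A \<and> module (class_ring :: complex ring) A \<and>
     (\<forall>a. \<forall>x \<in> carrier A. \<forall>y \<in> carrier A.
        (a \<odot>\<^bsub>A\<^esub> x) \<otimes>\<^bsub>A\<^esub> y = a \<odot>\<^bsub>A\<^esub> (x \<otimes>\<^bsub>A\<^esub> y) \<and>
        x \<otimes>\<^bsub>A\<^esub> (a \<odot>\<^bsub>A\<^esub> y) = a \<odot>\<^bsub>A\<^esub> (x \<otimes>\<^bsub>A\<^esub> y))"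

definition algebra_iso ::
    "(complex, 'a) module \<Rightarrow> (complex, 'b) module \<Rightarrow> ('a \<Rightarrow> 'b) set" where
  "algebra_iso A B =
     {h \<in> ring_iso A B. \<forall>a. \<forall>x \<in> carrier A. h (a \<odot>\<^bsub>A\<^esub> x) = a \<odot>\<^bsub>B\<^esub> h x}"

definition algebra_isomorphic ::
    "(complex, 'a) module \<Rightarrow> (complex, 'b) module \<Rightarrow> bool" where
  "algebra_isomorphic A B \<longleftrightarrow>
     complex_algebra A \<and> complex_algebra B \<and> algebra_iso A B \<noteq> {}"

abbreviation mat_algebra :: "nat \<Rightarrow> (complex, complex mat) module" where
  "mat_algebra m \<equiv> module_mat TYPE(complex) m m"

text \<open>Elements of the direct sum are families indexed by \<open>I\<close>. No finite support condition is
  imposed, so this is the direct sum only for finite \<open>I\<close> (and is then unital).\<close>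

definition direct_sum_algebra ::
    "'i set \<Rightarrow> ('i \<Rightarrow> (complex, 'a) module) \<Rightarrow> (complex, 'i \<Rightarrow> 'a) module" where
  "direct_sum_algebra I A =
     \<lparr>carrier = (\<Pi>\<^sub>E i\<in>I. carrier (A i)),
      mult = (\<lambda>x y. \<lambda>i\<in>I. x i \<otimes>\<^bsub>A i\<^esub> y i),
      one = (\<lambda>i\<in>I. \<one>\<^bsub>A i\<^esub>),
      zero = (\<lambda>i\<in>I. \<zero>\<^bsub>A i\<^esub>),
      add = (\<lambda>x y. \<lambda>i\<in>I. x i \<oplus>\<^bsub>A i\<^esub> y i),
      smult = (\<lambda>a x. \<lambda>i\<in>I. a \<odot>\<^bsub>A i\<^esub> x i)\<rparr>"

section \<open>Colored diagrams and their algebra\<close>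

text \<open>A triple \<open>(i, j, k)\<close> is the edge of color \<open>k\<close> from top vertex \<open>i\<close> to bottom vertex \<open>j\<close>;
  a diagram is its set of edges. The first condition says that distinct edges (including parallel
  edges of different colors) share no vertex.\<close>

type_synonym diagram = "(nat \<times> nat \<times> nat) set"

definition diagrams :: "nat \<Rightarrow> nat \<Rightarrow> diagram set" where
  "diagrams n c = {d. d \<subseteq> {1..n} \<times> {1..n} \<times> {1..c} \<and>
     (\<forall>i j k i' j' k'. (i, j, k) \<in> d \<and> (i', j', k') \<in> d \<and> (i = i' \<or> j = j')
        \<longrightarrow> (i, j, k) = (i', j', k')) \<and>
     (\<forall>i j i' j' k. (i, j, k) \<in> d \<and> (i', j', k) \<in> d \<and> i < i' \<longrightarrow> j < j')}"

definition diagram_mult :: "diagram \<Rightarrow> diagram \<Rightarrow> diagram" where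
  "diagram_mult d\<^sub>1 d\<^sub>2 = {(i, l, k). \<exists>j. (i, j, k) \<in> d\<^sub>1 \<and> (j, l, k) \<in> d\<^sub>2}"

lemma diagram_mult_iff:
  "(i, l, k) \<in> diagram_mult d\<^sub>1 d\<^sub>2 \<longleftrightarrow> (\<exists>j. (i, j, k) \<in> d\<^sub>1 \<and> (j, l, k) \<in> d\<^sub>2)"
  by (simp add: diagram_mult_def)

lemma diagram_mult_closed:
  assumes "d\<^sub>1 \<in> diagrams n c" "d\<^sub>2 \<in> diagrams n c"
  shows "diagram_mult d\<^sub>1 d\<^sub>2 \<in> diagrams n c"
proof -
  note diagramD = diagrams_def[THEN equalityD1, THEN subsetD, unfolded mem_Collect_eq]
  note sub = diagramD[THEN conjunct1, THEN subsetD]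
  note inj = diagramD[THEN conjunct2, THEN conjunct1, rule_format, OF _ conjI[OF _ conjI]]
  note mono = diagramD[THEN conjunct2, THEN conjunct2, rule_format, OF _ conjI[OF _ conjI]]
  show ?thesis
    unfolding diagrams_def mem_Collect_eq
  proof (intro conjI allI impI)
    show "diagram_mult d\<^sub>1 d\<^sub>2 \<subseteq> {1..n} \<times> {1..n} \<times> {1..c}"
    proof (rule subsetI)
      fix e assume e: "e \<in> diagram_mult d\<^sub>1 d\<^sub>2"
      obtain i l k where [simp]: "e = (i, l, k)"
        by (rule prod_cases3)
      from e obtain j where "(i, j, k) \<in> d\<^sub>1" "(j, l, k) \<in> d\<^sub>2"
        by (simp only: \<open>e = _\<close> diagram_mult_iff) (elim exE conjE)
      from sub[OF assms(1) this(1)] sub[OF assms(2) this(2)]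
      show "e \<in> {1..n} \<times> {1..n} \<times> {1..c}"
        by simp
    qed
  next
    fix i l k i' l' k'
    assume asm: "(i, l, k) \<in> diagram_mult d\<^sub>1 d\<^sub>2 \<and> (i', l', k') \<in> diagram_mult d\<^sub>1 d\<^sub>2 \<and> (i = i' \<or> l = l')"
    then obtain j j' where *: "(i, j, k) \<in> d\<^sub>1" "(j, l, k) \<in> d\<^sub>2" "(i', j', k') \<in> d\<^sub>1" "(j', l', k') \<in> d\<^sub>2"
      by (simp only: diagram_mult_iff) (elim exE conjE)
    from asm have "i = i' \<or> l = l'" by (elim conjE)
    then have "j = j'"
    proof
      assume "i = i'"
      from inj[OF assms(1) *(1,3) disjI1[OF this]] show ?thesis by simp
    next
      assume "l = l'"
      from inj[OF assms(2) *(2,4) disjI2[OF this]] show ?thesis by simp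
    qed
    from inj[OF assms(1) *(1,3) disjI2[OF this]] inj[OF assms(2) *(2,4) disjI1[OF this]]
    show "(i, l, k) = (i', l', k')" by simp
  next
    fix i l i' l' k
    assume asm: "(i, l, k) \<in> diagram_mult d\<^sub>1 d\<^sub>2 \<and> (i', l', k) \<in> diagram_mult d\<^sub>1 d\<^sub>2 \<and> i < i'"
    then obtain j j' where *: "(i, j, k) \<in> d\<^sub>1" "(j, l, k) \<in> d\<^sub>2" "(i', j', k) \<in> d\<^sub>1" "(j', l', k) \<in> d\<^sub>2"
      by (simp only: diagram_mult_iff) (elim exE conjE)
    from asm have less: "i < i'" by (elim conjE)
    show "l < l'"
      by (rule mono[OF assms(2) *(2,4) mono[OF assms(1) *(1,3) less]])
  qed
qed

lemma diagram_mult_assoc: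
  "diagram_mult (diagram_mult d\<^sub>1 d\<^sub>2) d\<^sub>3 = diagram_mult d\<^sub>1 (diagram_mult d\<^sub>2 d\<^sub>3)"
proof -
  have "(i, l, k) \<in> diagram_mult (diagram_mult d\<^sub>1 d\<^sub>2) d\<^sub>3 \<longleftrightarrow>
      (i, l, k) \<in> diagram_mult d\<^sub>1 (diagram_mult d\<^sub>2 d\<^sub>3)" for i l k
    unfolding diagram_mult_iff by blast
  then show ?thesis
    by (simp add: set_eq_iff)
qed

text \<open>An element of the algebra with basis \<^term>\<open>diagrams n c\<close> is represented by its coefficient
  function, extended by zero. The identity element is in general not a diagram but a linear
  combination of diagrams, so it is specified by its defining property.\<close>

definition diagram_space :: "nat \<Rightarrow> nat \<Rightarrow> (diagram \<Rightarrow> complex) set" where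
  "diagram_space n c = {f. \<forall>d. d \<notin> diagrams n c \<longrightarrow> f d = 0}"

definition convolution ::
    "nat \<Rightarrow> nat \<Rightarrow> (diagram \<Rightarrow> complex) \<Rightarrow> (diagram \<Rightarrow> complex) \<Rightarrow> diagram \<Rightarrow> complex" where
  "convolution n c f g = (\<lambda>d.
     \<Sum>(d\<^sub>1, d\<^sub>2) \<in> {(d\<^sub>1, d\<^sub>2) \<in> diagrams n c \<times> diagrams n c. diagram_mult d\<^sub>1 d\<^sub>2 = d}. f d\<^sub>1 * g d\<^sub>2)"

definition diagram_algebra :: "nat \<Rightarrow> nat \<Rightarrow> (complex, diagram \<Rightarrow> complex) module" where
  "diagram_algebra n c =
     \<lparr>carrier = diagram_space n c,
      mult = convolution n c,
      one = (THE e. e \<in> diagram_space n c \<and>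
               (\<forall>f \<in> diagram_space n c. convolution n c e f = f \<and> convolution n c f e = f)),
      zero = (\<lambda>d. 0),
      add = (\<lambda>f g d. f d + g d),
      smult = (\<lambda>a f d. a * f d)\<rparr>"

section \<open>Compositions and multinomial coefficients\<close>

definition weak_compositions :: "nat \<Rightarrow> nat \<Rightarrow> nat list set" where
  "weak_compositions n m = {ns. length ns = m \<and> sum_list ns = n}"

definition multinomial :: "nat list \<Rightarrow> nat" where
  "multinomial ns = fact (sum_list ns) div prod_list (map fact ns)"

end

theory Submission
  imports Defs "HOL-Combinatorics.Multiset_Permutations"
begin

text \<open>Reading off the colors of the top and of the bottom vertices (with \<open>0\<close> for a vertex without
  edge) identifies the diagrams with the pairs of words \<open>v, w\<close> in \<open>{0..c}\<^sup>n\<close> that have the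
  same number of occurrences of every letter, since the non-crossing condition leaves only one way of
  joining the vertices. If such a diagram \<open>d(v, w)\<close> is contained in a product \<open>pq\<close>, then there is
  exactly one word \<open>u\<close> with \<open>d(v, u) \<subseteq> p\<close> and \<open>d(u, w) \<subseteq> q\<close>. Hence the zeta transform
  \<open>f \<mapsto> (\<lambda>d. \<Sum>p \<supseteq> d. f p)\<close> turns the product of the algebra into a product of
  matrices indexed by words of a fixed content, and it is bijective by Moebius inversion, because the
  sub-diagrams of a diagram form a Boolean lattice.\<close>

section \<open>Diagrams as pairs of words\<close>

text \<open>Vertices are numbered from 1 and list entries from 0. The bound \<open>1 \<le> i\<close>
  keeps out \<open>i = 0\<close>, for which the truncated difference \<open>i - 1\<close> would also
  point at the first letter.\<close>

definition positions :: "nat list \<Rightarrow> nat \<Rightarrow> nat set" where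
  "positions w k = {i. 1 \<le> i \<and> i \<le> length w \<and> w ! (i - 1) = k}"

text \<open>Non-crossing forces the edges of color \<open>k\<close> to join the vertices of color \<open>k\<close> of equal rank.\<close>

definition word_diagram :: "nat list \<Rightarrow> nat list \<Rightarrow> diagram" where
  "word_diagram v w = {(i, j, k). 0 < k \<and> i \<in> positions v k \<and> j \<in> positions w k \<and>
     card {i' \<in> positions v k. i' < i} = card {j' \<in> positions w k. j' < j}}"

text \<open>Exchanging the rows turns each statement about top vertices into its bottom counterpart,
  so that only one side has to be treated.\<close>

definition flip :: "diagram \<Rightarrow> diagram" where
  "flip d = {(j, i, k). (i, j, k) \<in> d}"

text \<open>The sum is over at most one color; an uncolored vertex gets the empty sum \<open>0\<close>.\<close>

definition top_word :: "nat \<Rightarrow> diagram \<Rightarrow> nat list" where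
  "top_word n d = map (\<lambda>i. \<Sum>{k. \<exists>j. (i, j, k) \<in> d}) [1..<Suc n]"

abbreviation bottom_word :: "nat \<Rightarrow> diagram \<Rightarrow> nat list" where
  "bottom_word n d \<equiv> top_word n (flip d)"

section \<open>Positions of letters and ranks within a finite set\<close>

lemma finite_positions [simp]: "finite (positions w k)"
  by (rule finite_subset[of _ "{..length w}"]) (auto simp: positions_def)

lemma card_positions: "card (positions w k) = count (mset w) k"
proof -
  have "i \<in> Suc ` {i. i < length w \<and> w ! i = k}" if "i \<in> positions w k" for i
    using that by (intro image_eqI[of _ _ "i - 1"]) (auto simp: positions_def)
  moreover have "Suc ` {i. i < length w \<and> w ! i = k} \<subseteq> positions w k"
    by (auto simp: positions_def)
  ultimately have "positions w k = Suc ` {i. i < length w \<and> w ! i = k}"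
    by blast
  moreover have "{i. i < length w \<and> w ! i = k} = {i. i < length w \<and> k = w ! i}"
    by auto
  ultimately show ?thesis
    by (simp add: card_image count_mset count_list_eq_length_filter length_filter_conv_card)
qed

text \<open>The places not occupied by a positive letter can only hold \<open>0\<close>. Diagrams
  record positive colors only, which is why the criterion has this form.\<close>

lemma word_eqI:
  assumes "length v = length w" and "\<And>k. k > 0 \<Longrightarrow> positions v k = positions w k"
  shows "v = w"
proof (rule nth_equalityI[OF assms(1)])
  fix i assume i: "i < length v"
  have "v ! i = k \<longleftrightarrow> w ! i = k" if "k > 0" for k
  proof -
    have "v ! i = k \<longleftrightarrow> Suc i \<in> positions v k" using i by (auto simp: positions_def)
    also have "\<dots> \<longleftrightarrow> Suc i \<in> positions w k" using assms(2)[OF that] by simp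
    also have "\<dots> \<longleftrightarrow> w ! i = k" using i assms(1) by (auto simp: positions_def)
    finally show ?thesis .
  qed
  from this[of "v ! i"] this[of "w ! i"] show "v ! i = w ! i" by linarith
qed

lemma positions_disjoint: "i \<in> positions w k \<Longrightarrow> i \<in> positions w l \<Longrightarrow> k = l"
  by (simp add: positions_def)

lemma rank_less:
  fixes A :: "nat set"
  assumes "finite A" "i \<in> A" "i < i'"
  shows "card {x \<in> A. x < i} < card {x \<in> A. x < i'}"
proof (rule psubset_card_mono)
  have "i \<in> {x \<in> A. x < i'}" "i \<notin> {x \<in> A. x < i}" using assms by auto
  moreover have "{x \<in> A. x < i} \<subseteq> {x \<in> A. x < i'}" using assms(3) by auto
  ultimately show "{x \<in> A. x < i} \<subset> {x \<in> A. x < i'}" by blast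
qed (use assms(1) in simp)

lemma rank_less_iff:
  fixes A :: "nat set"
  assumes "finite A" "i \<in> A" "i' \<in> A"
  shows "card {x \<in> A. x < i} < card {x \<in> A. x < i'} \<longleftrightarrow> i < i'"
  using rank_less[OF assms(1,2), of i'] rank_less[OF assms(1,3), of i]
  by (cases i i' rule: linorder_cases) auto

lemma rank_inj:
  fixes A :: "nat set"
  assumes "finite A" "i \<in> A" "i' \<in> A" "card {x \<in> A. x < i} = card {x \<in> A. x < i'}"
  shows "i = i'"
  using rank_less_iff[of A i i'] rank_less_iff[of A i' i] assms by auto

text \<open>Ranks are below \<open>card A\<close> and pairwise distinct, so by counting they exhaust
  \<open>{..<card A}\<close>.\<close>

lemma rank_image:
  fixes A :: "nat set"
  assumes "finite A"
  shows "(\<lambda>i. card {x \<in> A. x < i}) ` A = {..<card A}"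
proof (rule card_subset_eq)
  show "(\<lambda>i. card {x \<in> A. x < i}) ` A \<subseteq> {..<card A}"
    using assms by (auto intro!: psubset_card_mono)
  show "card ((\<lambda>i. card {x \<in> A. x < i}) ` A) = card {..<card A}"
    using rank_inj[OF assms] by (subst card_image) (auto intro: inj_onI)
qed simp

section \<open>Basic properties of diagrams and their reflection\<close>

lemma diagrams_range:
  "d \<in> diagrams n c \<Longrightarrow> (i, j, k) \<in> d \<Longrightarrow> i \<in> {1..n} \<and> j \<in> {1..n} \<and> k \<in> {1..c}"
  unfolding diagrams_def by blast

lemma diagrams_top_inj:
  "d \<in> diagrams n c \<Longrightarrow> (i, j, k) \<in> d \<Longrightarrow> (i, j', k') \<in> d \<Longrightarrow> j = j' \<and> k = k'"
  unfolding diagrams_def by blast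

lemma diagrams_bottom_inj:
  "d \<in> diagrams n c \<Longrightarrow> (i, j, k) \<in> d \<Longrightarrow> (i', j, k') \<in> d \<Longrightarrow> i = i' \<and> k = k'"
  unfolding diagrams_def by blast

lemma diagrams_mono:
  "d \<in> diagrams n c \<Longrightarrow> (i, j, k) \<in> d \<Longrightarrow> (i', j', k) \<in> d \<Longrightarrow> i < i' \<Longrightarrow> j < j'"
  unfolding diagrams_def by blast

text \<open>All conditions on a diagram are universal statements about its edges. This is what makes
  the sub-diagrams of a diagram a full Boolean lattice.\<close>

lemma diagrams_subset: "d \<in> diagrams n c \<Longrightarrow> e \<subseteq> d \<Longrightarrow> e \<in> diagrams n c"
  unfolding diagrams_def by blast

lemma finite_diagrams [simp]: "finite (diagrams n c)"
proof (rule finite_subset)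
  show "diagrams n c \<subseteq> Pow ({1..n} \<times> {1..n} \<times> {1..c})"
    unfolding diagrams_def by blast
qed simp

lemma finite_diagram: "d \<in> diagrams n c \<Longrightarrow> finite d"
proof (rule finite_subset)
  assume "d \<in> diagrams n c"
  then show "d \<subseteq> {1..n} \<times> {1..n} \<times> {1..c}"
    unfolding diagrams_def by blast
qed simp

lemma in_flip [simp]: "(j, i, k) \<in> flip d \<longleftrightarrow> (i, j, k) \<in> d"
  by (simp add: flip_def)

lemma flip_diagrams:
  assumes "d \<in> diagrams n c"
  shows "flip d \<in> diagrams n c"
proof -
  \<comment> \<open>Non-crossing also holds from bottom to top: \<open>j' < j\<close> would give
    \<open>i' < i\<close>, and \<open>j = j'\<close> would give \<open>i = i'\<close>, because a
    vertex carries at most one edge.\<close>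
  have "j < j'" if "(j, i, k) \<in> d" "(j', i', k) \<in> d" "i < i'" for i j i' j' k
    using diagrams_mono[OF assms that(2,1)] diagrams_top_inj[OF assms that(1), of i' k] that
    by (cases j j' rule: linorder_cases) auto
  moreover have "flip d \<subseteq> {1..n} \<times> {1..n} \<times> {1..c}"
    using diagrams_range[OF assms] by (auto simp: flip_def)
  moreover have "(i, j, k) = (i', j', k')"
    if "(i, j, k) \<in> flip d" "(i', j', k') \<in> flip d" "i = i' \<or> j = j'" for i j k i' j' k'
    using that diagrams_top_inj[OF assms] diagrams_bottom_inj[OF assms] by (auto simp: flip_def)
  ultimately show ?thesis
    unfolding diagrams_def mem_Collect_eq in_flip by blast
qed

lemma flip_word_diagram: "flip (word_diagram v w) = word_diagram w v"
  by (auto simp: flip_def word_diagram_def)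

section \<open>The diagram of a pair of words\<close>

lemma word_diagram_iff:
  "(i, j, k) \<in> word_diagram v w \<longleftrightarrow> 0 < k \<and> i \<in> positions v k \<and> j \<in> positions w k \<and>
     card {i' \<in> positions v k. i' < i} = card {j' \<in> positions w k. j' < j}"
  by (simp add: word_diagram_def)

text \<open>With equal contents, both rows have the same number of vertices of color
  \<open>k\<close>, so the rank of \<open>i\<close> is also the rank of some
  \<open>j\<close>.\<close>

lemma word_diagram_total:
  assumes "mset v = mset w" "0 < k" "i \<in> positions v k"
  obtains j where "(i, j, k) \<in> word_diagram v w"
proof -
  have "card {i' \<in> positions v k. i' < i} \<in> {..<card (positions v k)}"
    using assms(3) by (auto intro!: psubset_card_mono)
  also have "\<dots> = (\<lambda>j. card {j' \<in> positions w k. j' < j}) ` positions w k"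
    by (simp add: rank_image card_positions assms(1))
  finally show thesis
    using that assms by (auto simp: word_diagram_iff)
qed

lemma word_diagram_in_diagrams:
  assumes "mset v = mset w" "length v = n" "set v \<subseteq> {..c}"
  shows "word_diagram v w \<in> diagrams n c"
proof -
  have len: "length w = n" using assms(1,2) by (metis size_mset)
  have *: "k \<le> c" if "i \<in> positions v k" for i k
  proof -
    from that have "v ! (i - 1) \<in> set v" "v ! (i - 1) = k" by (auto simp: positions_def)
    with assms(3) show ?thesis by auto
  qed
  \<comment> \<open>Stated for arbitrary words \<open>u\<close>, \<open>x\<close>, so that
    uniqueness at bottom vertices is the same fact for the reflected diagram.\<close>
  have 1: "j = j' \<and> k = k'" if "(i, j, k) \<in> word_diagram u x" "(i, j', k') \<in> word_diagram u x"
    for i j k j' k' u x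
    using that positions_disjoint[of i u k k'] rank_inj[of "positions x k" j j']
    by (auto simp: word_diagram_iff)
  have 2: "i = i' \<and> k = k'" if "(i, j, k) \<in> word_diagram v w" "(i', j, k') \<in> word_diagram v w"
    for i j k i' k'
    using 1[of j i k w v i' k'] that in_flip[of j i k "word_diagram v w"]
      in_flip[of j i' k' "word_diagram v w"] by (simp add: flip_word_diagram)
  \<comment> \<open>Edges preserve ranks, and within one color the order of vertices is the order of
    their ranks.\<close>
  have 3: "j < j'" if "(i, j, k) \<in> word_diagram v w" "(i', j', k) \<in> word_diagram v w" "i < i'"
    for i j i' j' k
    using that rank_less_iff[of "positions v k" i i'] rank_less_iff[of "positions w k" j j']
    by (auto simp: word_diagram_iff)
  have 4: "word_diagram v w \<subseteq> {1..n} \<times> {1..n} \<times> {1..c}"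
    using assms(2) len * by (auto simp: word_diagram_def positions_def Suc_le_eq)
  show ?thesis
    unfolding diagrams_def mem_Collect_eq using 1 2 3 4 by blast
qed

section \<open>The two words of a diagram\<close>

lemma length_top_word [simp]: "length (top_word n d) = n"
  by (simp add: top_word_def)

lemma top_word_nth:
  assumes "d \<in> diagrams n c" "i \<in> {1..n}"
  shows "(i, j, k) \<in> d \<Longrightarrow> top_word n d ! (i - 1) = k"
    and "(\<And>j k. (i, j, k) \<notin> d) \<Longrightarrow> top_word n d ! (i - 1) = 0"
proof -
  have *: "top_word n d ! (i - 1) = \<Sum>{k. \<exists>j. (i, j, k) \<in> d}"
    using assms(2) by (auto simp: top_word_def simp del: upt_Suc)
  { assume "(i, j, k) \<in> d"
    then have "{k. \<exists>j. (i, j, k) \<in> d} = {k}"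
      using diagrams_top_inj[OF assms(1)] by blast
    then show "top_word n d ! (i - 1) = k" unfolding * by simp }
  { assume "\<And>j k. (i, j, k) \<notin> d"
    then show "top_word n d ! (i - 1) = 0" unfolding * by simp }
qed

lemma positions_top_word:
  assumes "d \<in> diagrams n c" "k > 0"
  shows "positions (top_word n d) k = {i. \<exists>j. (i, j, k) \<in> d}"
proof (intro Set.set_eqI iffI)
  fix i assume "i \<in> positions (top_word n d) k"
  then have i: "i \<in> {1..n}" "top_word n d ! (i - 1) = k" by (auto simp: positions_def)
  then obtain j k' where "(i, j, k') \<in> d"
    using top_word_nth(2)[OF assms(1) i(1)] assms(2) by fastforce
  with top_word_nth(1)[OF assms(1) i(1) this] i show "i \<in> {i. \<exists>j. (i, j, k) \<in> d}"
    by auto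
next
  fix i assume "i \<in> {i. \<exists>j. (i, j, k) \<in> d}"
  then obtain j where "(i, j, k) \<in> d" by blast
  with top_word_nth(1)[OF assms(1) _ this] diagrams_range[OF assms(1) this]
  show "i \<in> positions (top_word n d) k" by (simp add: positions_def)
qed

lemma set_top_word:
  assumes "d \<in> diagrams n c"
  shows "set (top_word n d) \<subseteq> {..c}"
proof
  fix k assume "k \<in> set (top_word n d)"
  then obtain i where i: "i < n" "top_word n d ! i = k" by (auto simp: in_set_conv_nth)
  then have "k > 0 \<Longrightarrow> Suc i \<in> positions (top_word n d) k" by (simp add: positions_def)
  then have "k > 0 \<Longrightarrow> \<exists>j. (Suc i, j, k) \<in> d" using positions_top_word[OF assms] by auto
  then show "k \<in> {..c}" using diagrams_range[OF assms] by (cases "k = 0") auto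
qed

text \<open>The number of zeros is the length minus the number of positive letters.\<close>

lemma mset_eqI_pos:
  fixes v w :: "nat list"
  assumes "length v = length w" "\<And>k. k > 0 \<Longrightarrow> count (mset v) k = count (mset w) k"
  shows "mset v = mset w"
proof -
  have "filter_mset (\<lambda>k. k > 0) (mset v) = filter_mset (\<lambda>k. k > 0) (mset w)"
    using assms(2) by (intro multiset_eqI) simp
  moreover have "filter_mset (\<lambda>k. \<not> k > 0) (mset v) = filter_mset (\<lambda>k. \<not> k > 0) (mset w)"
  proof -
    have *: "filter_mset (\<lambda>k. \<not> k > 0) M = replicate_mset (size M - size (filter_mset (\<lambda>k. k > 0) M)) 0"
      for M :: "nat multiset"
    proof -
      have "size M = size (filter_mset (\<lambda>k. k > 0) M) + size (filter_mset (\<lambda>k. \<not> k > 0) M)"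
        by (metis multiset_partition size_union)
      moreover have "filter_mset (\<lambda>k. \<not> k > 0) M = replicate_mset (count M 0) 0"
        by (auto simp: multiset_eq_iff)
      ultimately show ?thesis by simp
    qed
    show ?thesis
      unfolding * using calculation assms(1) by simp
  qed
  ultimately show ?thesis by (metis multiset_partition)
qed

text \<open>The edges of color \<open>k\<close> are in bijection with their top ends and with their
  bottom ends, so each positive letter occurs equally often in both words.\<close>

lemma mset_top_bottom_word:
  assumes d: "d \<in> diagrams n c"
  shows "mset (top_word n d) = mset (bottom_word n d)"
proof (rule mset_eqI_pos)
  fix k :: nat assume "k > 0"
  let ?E = "{(i, j). (i, j, k) \<in> d}"
  have "card {i. \<exists>j. (i, j, k) \<in> d} = card ?E"
  proof -
    have "{i. \<exists>j. (i, j, k) \<in> d} = fst ` ?E" by (auto simp: image_iff)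
    moreover have "inj_on fst ?E" using diagrams_top_inj[OF d] by (auto simp: inj_on_def)
    ultimately show ?thesis by (simp add: card_image)
  qed
  also have "card ?E = card {j. \<exists>i. (i, j, k) \<in> d}"
  proof -
    have "{j. \<exists>i. (i, j, k) \<in> d} = snd ` ?E" by (auto simp: image_iff)
    moreover have "inj_on snd ?E" using diagrams_bottom_inj[OF d] by (auto simp: inj_on_def)
    ultimately show ?thesis by (simp add: card_image)
  qed
  finally show "count (mset (top_word n d)) k = count (mset (bottom_word n d)) k"
    using positions_top_word[OF d \<open>k > 0\<close>] positions_top_word[OF flip_diagrams[OF d] \<open>k > 0\<close>]
    by (simp flip: card_positions)
qed simp

lemma top_word_word_diagram:
  assumes "mset v = mset w" "length v = n" "set v \<subseteq> {..c}"
  shows "top_word n (word_diagram v w) = v"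
proof (rule word_eqI)
  fix k :: nat assume k: "k > 0"
  show "positions (top_word n (word_diagram v w)) k = positions v k"
    unfolding positions_top_word[OF word_diagram_in_diagrams[OF assms] k]
    using word_diagram_total[OF assms(1) k] by (auto simp: word_diagram_iff)
qed (simp add: assms)

lemma bottom_word_word_diagram:
  assumes "mset v = mset w" "length v = n" "set v \<subseteq> {..c}"
  shows "bottom_word n (word_diagram v w) = w"
  unfolding flip_word_diagram
proof (rule top_word_word_diagram)
  show "mset w = mset v" by (simp add: assms)
  show "length w = n" using assms by (metis size_mset)
  show "set w \<subseteq> {..c}" using assms by (metis set_mset_mset)
qed

text \<open>This is where non-crossing leaves no choice: an edge of \<open>d\<close> has equally
  many edges of its color to its left on either side, hence joins vertices of equal rank.\<close>

lemma word_diagram_top_bottom: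
  assumes d: "d \<in> diagrams n c"
  shows "word_diagram (top_word n d) (bottom_word n d) = d"
proof -
  let ?v = "top_word n d" and ?w = "bottom_word n d"
  note pos = positions_top_word[OF d] positions_top_word[OF flip_diagrams[OF d]]
  have sub: "(i, j, k) \<in> word_diagram ?v ?w" if e: "(i, j, k) \<in> d" for i j k
  proof -
    have k: "k > 0" using diagrams_range[OF d e] by simp
    have lt: "j' < j \<longleftrightarrow> i' < i" if "(i', j', k) \<in> d" for i' j'
      using diagrams_mono[OF d that e] diagrams_mono[OF d e that]
        diagrams_top_inj[OF d e, of j' k] diagrams_bottom_inj[OF d e, of i' k] that e
      by (cases i i' rule: linorder_cases) auto
    \<comment> \<open>The edges in \<open>?E\<close> project bijectively onto the vertices of color
      \<open>k\<close> left of \<open>i\<close> and, by \<open>lt\<close>, onto those left of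
      \<open>j\<close>.\<close>
    let ?E = "{(i', j'). (i', j', k) \<in> d \<and> i' < i}"
    have "{i' \<in> positions ?v k. i' < i} = fst ` ?E" using pos(1)[OF k] by (auto simp: image_iff)
    moreover have "inj_on fst ?E" using diagrams_top_inj[OF d] by (auto simp: inj_on_def)
    moreover have "{j' \<in> positions ?w k. j' < j} = snd ` ?E" using pos(2)[OF k] lt by (auto simp: image_iff)
    moreover have "inj_on snd ?E" using diagrams_bottom_inj[OF d] by (auto simp: inj_on_def)
    ultimately show ?thesis
      using e k pos[OF k] by (auto simp: word_diagram_iff card_image)
  qed
  have D: "word_diagram ?v ?w \<in> diagrams n c"
    by (rule word_diagram_in_diagrams[OF mset_top_bottom_word[OF d] length_top_word set_top_word[OF d]])
  \<comment> \<open>The top vertex \<open>i\<close> carries an edge of \<open>d\<close>, which by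
    \<open>sub\<close> lies in the word diagram as well. Two edges of the word diagram at
    \<open>i\<close> coincide.\<close>
  have "(i, j, k) \<in> d" if e: "(i, j, k) \<in> word_diagram ?v ?w" for i j k
  proof -
    from e have "i \<in> positions ?v k" "k > 0" by (auto simp: word_diagram_iff)
    then obtain j' where j': "(i, j', k) \<in> d" using pos(1) by auto
    from diagrams_top_inj[OF D e sub[OF this]] j' show ?thesis by simp
  qed
  with sub show ?thesis by auto
qed

section \<open>Words on the middle row of a product\<close>

lemma word_diagram_mult:
  assumes "mset v = mset u"
  shows "diagram_mult (word_diagram v u) (word_diagram u w) = word_diagram v w"
proof -
  have "\<exists>j. (i, j, k) \<in> word_diagram v u \<and> (j, l, k) \<in> word_diagram u w"
    if "(i, l, k) \<in> word_diagram v w" for i l k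
  proof -
    from that have k: "0 < k" "i \<in> positions v k" by (auto simp: word_diagram_iff)
    \<comment> \<open>The first half of the path exists because \<open>u\<close> has the content of
      \<open>v\<close>; the second half then only requires equal ranks.\<close>
    obtain j where "(i, j, k) \<in> word_diagram v u"
      by (rule word_diagram_total[OF assms k])
    with that show ?thesis by (auto simp: word_diagram_iff)
  qed
  moreover have "(i, l, k) \<in> word_diagram v w"
    if "(i, j, k) \<in> word_diagram v u" "(j, l, k) \<in> word_diagram u w" for i j l k
    using that by (auto simp: word_diagram_iff)
  ultimately show ?thesis
    unfolding diagram_mult_def by blast
qed

text \<open>A top vertex has only one edge in \<open>p\<close>, so both word diagrams use it, and
  its bottom end has the same color in \<open>u\<close> and in \<open>u'\<close>.\<close>

lemma middle_word_unique:
  assumes p: "p \<in> diagrams n c"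
    and "mset v = mset u" "mset v = mset u'"
    and "word_diagram v u \<subseteq> p" "word_diagram v u' \<subseteq> p"
  shows "u = u'"
proof -
  \<comment> \<open>One inclusion for an arbitrary pair of words; the other follows by exchanging
    \<open>u\<close> and \<open>u'\<close>.\<close>
  have *: "positions x k \<subseteq> positions x' k"
    if k: "k > 0" and x: "mset v = mset x" "mset v = mset x'"
      and sub: "word_diagram v x \<subseteq> p" "word_diagram v x' \<subseteq> p" for x x' k
  proof
    fix j assume "j \<in> positions x k"
    then obtain i where i: "(j, i, k) \<in> word_diagram x v"
      using word_diagram_total[OF x(1)[symmetric] k] by metis
    then have "(i, j, k) \<in> word_diagram v x" by (simp flip: flip_word_diagram[of v x])
    moreover obtain j' where j': "(i, j', k) \<in> word_diagram v x'"
      using word_diagram_total[OF x(2) k, of i] i by (auto simp: word_diagram_iff)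
    ultimately have "j = j'" using diagrams_top_inj[OF p] sub by blast
    with j' show "j \<in> positions x' k" by (simp add: word_diagram_iff)
  qed
  have "length u = length u'" using assms(2,3) by (metis size_mset)
  then show ?thesis using *[of _ u u'] *[of _ u' u] assms by (intro word_eqI) auto
qed

text \<open>Discard from \<open>p\<close> and \<open>q\<close> every edge that is not part of a path
  forming an edge of the given diagram. What remains meets the middle row in the same colored
  vertices from above and from below, and these spell \<open>u\<close>.\<close>

lemma middle_word_exists:
  assumes p: "p \<in> diagrams n c" and q: "q \<in> diagrams n c"
    and vw: "mset v = mset w" "length v = n" "set v \<subseteq> {..c}"
    and sub: "word_diagram v w \<subseteq> diagram_mult p q"
  obtains u where "mset v = mset u" "word_diagram v u \<subseteq> p" "word_diagram u w \<subseteq> q"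
proof -
  let ?d = "word_diagram v w"
  have d: "?d \<in> diagrams n c" by (rule word_diagram_in_diagrams[OF vw])
  define d1 where "d1 = {(i, j, k). (i, j, k) \<in> p \<and> (\<exists>l. (j, l, k) \<in> q \<and> (i, l, k) \<in> ?d)}"
  define d2 where "d2 = {(j, l, k). (j, l, k) \<in> q \<and> (\<exists>i. (i, j, k) \<in> p \<and> (i, l, k) \<in> ?d)}"
  have sub1: "d1 \<subseteq> p" and sub2: "d2 \<subseteq> q" by (auto simp: d1_def d2_def)
  have D: "d1 \<in> diagrams n c" "d2 \<in> diagrams n c"
    by (rule diagrams_subset[OF p sub1], rule diagrams_subset[OF q sub2])
  \<comment> \<open>Each edge of \<open>?d\<close> comes from a path through \<open>p\<close> and
    \<open>q\<close>, so \<open>d1\<close> still reaches all colored top vertices of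
    \<open>?d\<close>, and \<open>d2\<close> all colored bottom vertices.\<close>
  have ex: "\<exists>j. (i, j, k) \<in> p \<and> (j, l, k) \<in> q" if "(i, l, k) \<in> ?d" for i l k
    using subsetD[OF sub that] by (simp add: diagram_mult_iff)
  have "top_word n d1 = top_word n ?d"
  proof (rule word_eqI)
    fix k :: nat assume k: "k > 0"
    show "positions (top_word n d1) k = positions (top_word n ?d) k"
      unfolding positions_top_word[OF D(1) k] positions_top_word[OF d k]
      using ex by (auto simp: d1_def; blast)
  qed simp
  then have 1: "top_word n d1 = v" using top_word_word_diagram[OF vw] by simp
  have "bottom_word n d2 = bottom_word n ?d"
  proof (rule word_eqI)
    fix k :: nat assume k: "k > 0"
    show "positions (bottom_word n d2) k = positions (bottom_word n ?d) k"
      unfolding positions_top_word[OF flip_diagrams[OF D(2)] k] positions_top_word[OF flip_diagrams[OF d] k]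
      using ex by (auto simp: d2_def; blast)
  qed simp
  then have 2: "bottom_word n d2 = w" using bottom_word_word_diagram[OF vw] by simp
  \<comment> \<open>Both sides record the color \<open>k\<close> at exactly those \<open>j\<close>
    that are the middle vertex of a path of color \<open>k\<close> forming an edge of
    \<open>?d\<close>.\<close>
  have 3: "bottom_word n d1 = top_word n d2"
  proof (rule word_eqI)
    fix k :: nat assume k: "k > 0"
    show "positions (bottom_word n d1) k = positions (top_word n d2) k"
      unfolding positions_top_word[OF flip_diagrams[OF D(1)] k] positions_top_word[OF D(2) k]
      by (auto simp: d1_def d2_def)
  qed simp
  show thesis
  proof
    show "mset v = mset (top_word n d2)"
      using mset_top_bottom_word[OF D(1)] 1 3 by simp
    show "word_diagram v (top_word n d2) \<subseteq> p"
      using word_diagram_top_bottom[OF D(1)] sub1 1 3 by simp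
    show "word_diagram (top_word n d2) w \<subseteq> q"
      using word_diagram_top_bottom[OF D(2)] sub2 2 by simp
  qed
qed

section \<open>Complex algebras\<close>

text \<open>A list of closure properties and equations, suited to componentwise checks and to
  pulling back along an injective map. The additive inverse is given as the multiple by
  \<open>- 1\<close>, which avoids an existential statement.\<close>

lemma complex_algebraI:
  assumes "\<And>x y. x \<in> carrier A \<Longrightarrow> y \<in> carrier A \<Longrightarrow> x \<oplus>\<^bsub>A\<^esub> y \<in> carrier A"
    and "\<zero>\<^bsub>A\<^esub> \<in> carrier A"
    and "\<And>x y z. x \<in> carrier A \<Longrightarrow> y \<in> carrier A \<Longrightarrow> z \<in> carrier A \<Longrightarrow>
      x \<oplus>\<^bsub>A\<^esub> y \<oplus>\<^bsub>A\<^esub> z = x \<oplus>\<^bsub>A\<^esub> (y \<oplus>\<^bsub>A\<^esub> z)"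
    and "\<And>x y. x \<in> carrier A \<Longrightarrow> y \<in> carrier A \<Longrightarrow> x \<oplus>\<^bsub>A\<^esub> y = y \<oplus>\<^bsub>A\<^esub> x"
    and "\<And>x. x \<in> carrier A \<Longrightarrow> \<zero>\<^bsub>A\<^esub> \<oplus>\<^bsub>A\<^esub> x = x"
    and "\<And>x. x \<in> carrier A \<Longrightarrow> (- 1) \<odot>\<^bsub>A\<^esub> x \<oplus>\<^bsub>A\<^esub> x = \<zero>\<^bsub>A\<^esub>"
    and "\<And>x y. x \<in> carrier A \<Longrightarrow> y \<in> carrier A \<Longrightarrow> x \<otimes>\<^bsub>A\<^esub> y \<in> carrier A"
    and "\<one>\<^bsub>A\<^esub> \<in> carrier A"
    and "\<And>x y z. x \<in> carrier A \<Longrightarrow> y \<in> carrier A \<Longrightarrow> z \<in> carrier A \<Longrightarrow>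
      x \<otimes>\<^bsub>A\<^esub> y \<otimes>\<^bsub>A\<^esub> z = x \<otimes>\<^bsub>A\<^esub> (y \<otimes>\<^bsub>A\<^esub> z)"
    and "\<And>x. x \<in> carrier A \<Longrightarrow> \<one>\<^bsub>A\<^esub> \<otimes>\<^bsub>A\<^esub> x = x"
    and "\<And>x. x \<in> carrier A \<Longrightarrow> x \<otimes>\<^bsub>A\<^esub> \<one>\<^bsub>A\<^esub> = x"
    and "\<And>x y z. x \<in> carrier A \<Longrightarrow> y \<in> carrier A \<Longrightarrow> z \<in> carrier A \<Longrightarrow>
      (x \<oplus>\<^bsub>A\<^esub> y) \<otimes>\<^bsub>A\<^esub> z = x \<otimes>\<^bsub>A\<^esub> z \<oplus>\<^bsub>A\<^esub> y \<otimes>\<^bsub>A\<^esub> z"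
    and "\<And>x y z. x \<in> carrier A \<Longrightarrow> y \<in> carrier A \<Longrightarrow> z \<in> carrier A \<Longrightarrow>
      z \<otimes>\<^bsub>A\<^esub> (x \<oplus>\<^bsub>A\<^esub> y) = z \<otimes>\<^bsub>A\<^esub> x \<oplus>\<^bsub>A\<^esub> z \<otimes>\<^bsub>A\<^esub> y"
    and "\<And>a x. x \<in> carrier A \<Longrightarrow> a \<odot>\<^bsub>A\<^esub> x \<in> carrier A"
    and "\<And>a b x. x \<in> carrier A \<Longrightarrow> (a + b) \<odot>\<^bsub>A\<^esub> x = a \<odot>\<^bsub>A\<^esub> x \<oplus>\<^bsub>A\<^esub> b \<odot>\<^bsub>A\<^esub> x"
    and "\<And>a x y. x \<in> carrier A \<Longrightarrow> y \<in> carrier A \<Longrightarrow>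
      a \<odot>\<^bsub>A\<^esub> (x \<oplus>\<^bsub>A\<^esub> y) = a \<odot>\<^bsub>A\<^esub> x \<oplus>\<^bsub>A\<^esub> a \<odot>\<^bsub>A\<^esub> y"
    and "\<And>a b x. x \<in> carrier A \<Longrightarrow> (a * b) \<odot>\<^bsub>A\<^esub> x = a \<odot>\<^bsub>A\<^esub> (b \<odot>\<^bsub>A\<^esub> x)"
    and "\<And>x. x \<in> carrier A \<Longrightarrow> 1 \<odot>\<^bsub>A\<^esub> x = x"
    and "\<And>a x y. x \<in> carrier A \<Longrightarrow> y \<in> carrier A \<Longrightarrow>
      (a \<odot>\<^bsub>A\<^esub> x) \<otimes>\<^bsub>A\<^esub> y = a \<odot>\<^bsub>A\<^esub> (x \<otimes>\<^bsub>A\<^esub> y)"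
    and "\<And>a x y. x \<in> carrier A \<Longrightarrow> y \<in> carrier A \<Longrightarrow>
      x \<otimes>\<^bsub>A\<^esub> (a \<odot>\<^bsub>A\<^esub> y) = a \<odot>\<^bsub>A\<^esub> (x \<otimes>\<^bsub>A\<^esub> y)"
  shows "complex_algebra A"
proof -
  have ab: "abelian_group A"
  proof (rule abelian_groupI)
    show "\<exists>y \<in> carrier A. y \<oplus>\<^bsub>A\<^esub> x = \<zero>\<^bsub>A\<^esub>" if "x \<in> carrier A" for x
      by (rule bexI[of _ "(- 1) \<odot>\<^bsub>A\<^esub> x"]) (rule assms(6,14)[OF that])+
  qed (rule assms(1-5); assumption)+
  have m: "monoid A"
    by (rule monoidI; rule assms(7-11); assumption?)
  have "ring A"
    by (rule ringI[OF ab m]; rule assms(12,13); assumption?)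
  moreover have "Module.module (class_ring :: complex ring) A"
    by (rule moduleI[OF domain.axioms(1)[OF field.axioms(1)[OF class_field]] ab]; simp add: assms(14-18))
  ultimately show ?thesis
    unfolding complex_algebra_def by (simp add: assms(19,20))
qed

lemma complex_algebra_closed:
  assumes "complex_algebra A"
  shows "\<zero>\<^bsub>A\<^esub> \<in> carrier A" and "\<one>\<^bsub>A\<^esub> \<in> carrier A"
    and "x \<in> carrier A \<Longrightarrow> y \<in> carrier A \<Longrightarrow> x \<oplus>\<^bsub>A\<^esub> y \<in> carrier A"
    and "x \<in> carrier A \<Longrightarrow> y \<in> carrier A \<Longrightarrow> x \<otimes>\<^bsub>A\<^esub> y \<in> carrier A"
    and "x \<in> carrier A \<Longrightarrow> a \<odot>\<^bsub>A\<^esub> x \<in> carrier A"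
proof -
  interpret ring A using assms by (simp add: complex_algebra_def)
  interpret Module.module "class_ring :: complex ring" A
    using assms by (simp add: complex_algebra_def)
  show "\<zero>\<^bsub>A\<^esub> \<in> carrier A" "\<one>\<^bsub>A\<^esub> \<in> carrier A"
    and "x \<in> carrier A \<Longrightarrow> y \<in> carrier A \<Longrightarrow> x \<oplus>\<^bsub>A\<^esub> y \<in> carrier A"
    and "x \<in> carrier A \<Longrightarrow> y \<in> carrier A \<Longrightarrow> x \<otimes>\<^bsub>A\<^esub> y \<in> carrier A"
    and "x \<in> carrier A \<Longrightarrow> a \<odot>\<^bsub>A\<^esub> x \<in> carrier A"
    using smult_closed[of a x] by simp_all
qed

text \<open>The equations of \<open>complex_algebraI\<close> in reverse direction. Commutativity of
  addition stands last because it serves as a rewrite rule only in instantiated form.\<close>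

lemma complex_algebra_laws:
  assumes "complex_algebra A"
  shows "x \<in> carrier A \<Longrightarrow> y \<in> carrier A \<Longrightarrow> z \<in> carrier A \<Longrightarrow>
      x \<oplus>\<^bsub>A\<^esub> y \<oplus>\<^bsub>A\<^esub> z = x \<oplus>\<^bsub>A\<^esub> (y \<oplus>\<^bsub>A\<^esub> z)"
    and "x \<in> carrier A \<Longrightarrow> \<zero>\<^bsub>A\<^esub> \<oplus>\<^bsub>A\<^esub> x = x"
    and "x \<in> carrier A \<Longrightarrow> (- 1) \<odot>\<^bsub>A\<^esub> x \<oplus>\<^bsub>A\<^esub> x = \<zero>\<^bsub>A\<^esub>"
    and "x \<in> carrier A \<Longrightarrow> y \<in> carrier A \<Longrightarrow> z \<in> carrier A \<Longrightarrow>
      x \<otimes>\<^bsub>A\<^esub> y \<otimes>\<^bsub>A\<^esub> z = x \<otimes>\<^bsub>A\<^esub> (y \<otimes>\<^bsub>A\<^esub> z)"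
    and "x \<in> carrier A \<Longrightarrow> \<one>\<^bsub>A\<^esub> \<otimes>\<^bsub>A\<^esub> x = x"
    and "x \<in> carrier A \<Longrightarrow> x \<otimes>\<^bsub>A\<^esub> \<one>\<^bsub>A\<^esub> = x"
    and "x \<in> carrier A \<Longrightarrow> y \<in> carrier A \<Longrightarrow> z \<in> carrier A \<Longrightarrow>
      (x \<oplus>\<^bsub>A\<^esub> y) \<otimes>\<^bsub>A\<^esub> z = x \<otimes>\<^bsub>A\<^esub> z \<oplus>\<^bsub>A\<^esub> y \<otimes>\<^bsub>A\<^esub> z"
    and "x \<in> carrier A \<Longrightarrow> y \<in> carrier A \<Longrightarrow> z \<in> carrier A \<Longrightarrow>
      z \<otimes>\<^bsub>A\<^esub> (x \<oplus>\<^bsub>A\<^esub> y) = z \<otimes>\<^bsub>A\<^esub> x \<oplus>\<^bsub>A\<^esub> z \<otimes>\<^bsub>A\<^esub> y"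
    and "x \<in> carrier A \<Longrightarrow> (a + b) \<odot>\<^bsub>A\<^esub> x = a \<odot>\<^bsub>A\<^esub> x \<oplus>\<^bsub>A\<^esub> b \<odot>\<^bsub>A\<^esub> x"
    and "x \<in> carrier A \<Longrightarrow> y \<in> carrier A \<Longrightarrow>
      a \<odot>\<^bsub>A\<^esub> (x \<oplus>\<^bsub>A\<^esub> y) = a \<odot>\<^bsub>A\<^esub> x \<oplus>\<^bsub>A\<^esub> a \<odot>\<^bsub>A\<^esub> y"
    and "x \<in> carrier A \<Longrightarrow> (a * b) \<odot>\<^bsub>A\<^esub> x = a \<odot>\<^bsub>A\<^esub> (b \<odot>\<^bsub>A\<^esub> x)"
    and "x \<in> carrier A \<Longrightarrow> 1 \<odot>\<^bsub>A\<^esub> x = x"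
    and "x \<in> carrier A \<Longrightarrow> y \<in> carrier A \<Longrightarrow>
      (a \<odot>\<^bsub>A\<^esub> x) \<otimes>\<^bsub>A\<^esub> y = a \<odot>\<^bsub>A\<^esub> (x \<otimes>\<^bsub>A\<^esub> y)"
    and "x \<in> carrier A \<Longrightarrow> y \<in> carrier A \<Longrightarrow>
      x \<otimes>\<^bsub>A\<^esub> (a \<odot>\<^bsub>A\<^esub> y) = a \<odot>\<^bsub>A\<^esub> (x \<otimes>\<^bsub>A\<^esub> y)"
    and "x \<in> carrier A \<Longrightarrow> y \<in> carrier A \<Longrightarrow> x \<oplus>\<^bsub>A\<^esub> y = y \<oplus>\<^bsub>A\<^esub> x"
proof -
  interpret ring A using assms by (simp add: complex_algebra_def)
  interpret M: Module.module "class_ring :: complex ring" A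
    using assms by (simp add: complex_algebra_def)
  show "x \<in> carrier A \<Longrightarrow> y \<in> carrier A \<Longrightarrow> x \<oplus>\<^bsub>A\<^esub> y = y \<oplus>\<^bsub>A\<^esub> x"
    and "x \<in> carrier A \<Longrightarrow> y \<in> carrier A \<Longrightarrow> z \<in> carrier A \<Longrightarrow>
      x \<oplus>\<^bsub>A\<^esub> y \<oplus>\<^bsub>A\<^esub> z = x \<oplus>\<^bsub>A\<^esub> (y \<oplus>\<^bsub>A\<^esub> z)"
    and "x \<in> carrier A \<Longrightarrow> \<zero>\<^bsub>A\<^esub> \<oplus>\<^bsub>A\<^esub> x = x"
    and "x \<in> carrier A \<Longrightarrow> y \<in> carrier A \<Longrightarrow> z \<in> carrier A \<Longrightarrow>
      x \<otimes>\<^bsub>A\<^esub> y \<otimes>\<^bsub>A\<^esub> z = x \<otimes>\<^bsub>A\<^esub> (y \<otimes>\<^bsub>A\<^esub> z)"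
    and "x \<in> carrier A \<Longrightarrow> \<one>\<^bsub>A\<^esub> \<otimes>\<^bsub>A\<^esub> x = x"
    and "x \<in> carrier A \<Longrightarrow> x \<otimes>\<^bsub>A\<^esub> \<one>\<^bsub>A\<^esub> = x"
    and "x \<in> carrier A \<Longrightarrow> y \<in> carrier A \<Longrightarrow> z \<in> carrier A \<Longrightarrow>
      (x \<oplus>\<^bsub>A\<^esub> y) \<otimes>\<^bsub>A\<^esub> z = x \<otimes>\<^bsub>A\<^esub> z \<oplus>\<^bsub>A\<^esub> y \<otimes>\<^bsub>A\<^esub> z"
    and "x \<in> carrier A \<Longrightarrow> y \<in> carrier A \<Longrightarrow> z \<in> carrier A \<Longrightarrow>
      z \<otimes>\<^bsub>A\<^esub> (x \<oplus>\<^bsub>A\<^esub> y) = z \<otimes>\<^bsub>A\<^esub> x \<oplus>\<^bsub>A\<^esub> z \<otimes>\<^bsub>A\<^esub> y"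
    by (fact a_comm a_assoc l_zero m_assoc l_one r_one l_distr r_distr)+
  show distr: "x \<in> carrier A \<Longrightarrow> (a + b) \<odot>\<^bsub>A\<^esub> x = a \<odot>\<^bsub>A\<^esub> x \<oplus>\<^bsub>A\<^esub> b \<odot>\<^bsub>A\<^esub> x" for a b
    using M.smult_l_distr[of a b x] by simp
  show "x \<in> carrier A \<Longrightarrow> y \<in> carrier A \<Longrightarrow>
      a \<odot>\<^bsub>A\<^esub> (x \<oplus>\<^bsub>A\<^esub> y) = a \<odot>\<^bsub>A\<^esub> x \<oplus>\<^bsub>A\<^esub> a \<odot>\<^bsub>A\<^esub> y"
    using M.smult_r_distr[of a x y] by simp
  show "x \<in> carrier A \<Longrightarrow> (a * b) \<odot>\<^bsub>A\<^esub> x = a \<odot>\<^bsub>A\<^esub> (b \<odot>\<^bsub>A\<^esub> x)"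
    using M.smult_assoc1[of a b x] by simp
  show one: "x \<in> carrier A \<Longrightarrow> 1 \<odot>\<^bsub>A\<^esub> x = x"
    using M.smult_one[of x] by simp
  show "x \<in> carrier A \<Longrightarrow> (- 1) \<odot>\<^bsub>A\<^esub> x \<oplus>\<^bsub>A\<^esub> x = \<zero>\<^bsub>A\<^esub>"
    using distr[of "- 1" 1] one M.smult_l_null[of x] by simp
  show "x \<in> carrier A \<Longrightarrow> y \<in> carrier A \<Longrightarrow>
      (a \<odot>\<^bsub>A\<^esub> x) \<otimes>\<^bsub>A\<^esub> y = a \<odot>\<^bsub>A\<^esub> (x \<otimes>\<^bsub>A\<^esub> y)"
    and "x \<in> carrier A \<Longrightarrow> y \<in> carrier A \<Longrightarrow>
      x \<otimes>\<^bsub>A\<^esub> (a \<odot>\<^bsub>A\<^esub> y) = a \<odot>\<^bsub>A\<^esub> (x \<otimes>\<^bsub>A\<^esub> y)"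
    using assms by (simp_all add: complex_algebra_def)
qed

section \<open>Matrix algebras and direct sums\<close>

lemma complex_algebra_mat: "complex_algebra (mat_algebra m)"
proof -
  have "monoid (mat_algebra m)"
    by (rule monoidI) (auto simp: module_mat_simps intro: assoc_mult_mat)
  then have "ring (mat_algebra m)"
    by (intro ringI abelian_group_mat)
      (auto simp: module_mat_simps intro: add_mult_distrib_mat mult_add_distrib_mat)
  moreover have "Module.module (class_ring :: complex ring) (mat_algebra m)"
    using matrix_vs[where ?'a = complex] by (simp add: vectorspace_def)
  ultimately show ?thesis
    unfolding complex_algebra_def module_mat_simps
    by (auto intro: mult_smult_assoc_mat mult_smult_distrib)
qed

lemma direct_sum_algebra_simps:
  "carrier (direct_sum_algebra I A) = (\<Pi>\<^sub>E i\<in>I. carrier (A i))"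
  "x \<otimes>\<^bsub>direct_sum_algebra I A\<^esub> y = (\<lambda>i\<in>I. x i \<otimes>\<^bsub>A i\<^esub> y i)"
  "x \<oplus>\<^bsub>direct_sum_algebra I A\<^esub> y = (\<lambda>i\<in>I. x i \<oplus>\<^bsub>A i\<^esub> y i)"
  "a \<odot>\<^bsub>direct_sum_algebra I A\<^esub> x = (\<lambda>i\<in>I. a \<odot>\<^bsub>A i\<^esub> x i)"
  "\<one>\<^bsub>direct_sum_algebra I A\<^esub> = (\<lambda>i\<in>I. \<one>\<^bsub>A i\<^esub>)"
  "\<zero>\<^bsub>direct_sum_algebra I A\<^esub> = (\<lambda>i\<in>I. \<zero>\<^bsub>A i\<^esub>)"
  by (simp_all add: direct_sum_algebra_def)

lemma complex_algebra_direct_sum: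
  assumes "\<And>i. i \<in> I \<Longrightarrow> complex_algebra (A i)"
  shows "complex_algebra (direct_sum_algebra I A)"
proof -
  note closed = complex_algebra_closed[OF assms] and laws = complex_algebra_laws[OF assms]
  have mem: "f i \<in> carrier (A i)" if "f \<in> (\<Pi>\<^sub>E i\<in>I. carrier (A i))" "i \<in> I" for f i
    using that by (rule PiE_mem)
  show ?thesis
    by (rule complex_algebraI; unfold direct_sum_algebra_simps;
        (rule PiE_ext[where k = I and s = "\<lambda>i. carrier (A i)"])?)
      (simp_all add: laws(1-14) closed mem restrict_PiE_iff laws(15)[OF _ mem mem])
qed

text \<open>Only the target is assumed to be an algebra. The laws of \<open>A\<close> are pulled
  back along the injective map \<open>h\<close>, so associativity and the unit laws of the diagram
  algebra come from the matrices.\<close>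

lemma algebra_isomorphicI:
  assumes B: "complex_algebra B" and h: "bij_betw h (carrier A) (carrier B)"
    and add: "\<And>x y. x \<in> carrier A \<Longrightarrow> y \<in> carrier A \<Longrightarrow>
      x \<oplus>\<^bsub>A\<^esub> y \<in> carrier A \<and> h (x \<oplus>\<^bsub>A\<^esub> y) = h x \<oplus>\<^bsub>B\<^esub> h y"
    and mult: "\<And>x y. x \<in> carrier A \<Longrightarrow> y \<in> carrier A \<Longrightarrow>
      x \<otimes>\<^bsub>A\<^esub> y \<in> carrier A \<and> h (x \<otimes>\<^bsub>A\<^esub> y) = h x \<otimes>\<^bsub>B\<^esub> h y"
    and smult: "\<And>a x. x \<in> carrier A \<Longrightarrow>
      a \<odot>\<^bsub>A\<^esub> x \<in> carrier A \<and> h (a \<odot>\<^bsub>A\<^esub> x) = a \<odot>\<^bsub>B\<^esub> h x"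
    and zero: "\<zero>\<^bsub>A\<^esub> \<in> carrier A" "h \<zero>\<^bsub>A\<^esub> = \<zero>\<^bsub>B\<^esub>"
    and one: "\<one>\<^bsub>A\<^esub> \<in> carrier A" "h \<one>\<^bsub>A\<^esub> = \<one>\<^bsub>B\<^esub>"
  shows "algebra_isomorphic A B"
proof -
  have hc: "h x \<in> carrier B" if "x \<in> carrier A" for x using that h by (auto simp: bij_betw_def)
  have eqI: "x = y" if "h x = h y" "x \<in> carrier A" "y \<in> carrier A" for x y
    using that h by (auto simp: bij_betw_def inj_on_def)
  note simps = add mult smult zero one hc
  note laws = complex_algebra_laws[OF B] and closed = complex_algebra_closed[OF B]
  have "complex_algebra A"
    by (rule complex_algebraI; (rule eqI)?)
      (simp_all add: simps laws(1-14) closed laws(15)[OF hc hc])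
  moreover have "h \<in> algebra_iso A B"
    unfolding algebra_iso_def ring_iso_def using h by (auto simp: simps intro!: ring_hom_memI)
  ultimately show ?thesis using B unfolding algebra_isomorphic_def by blast
qed

section \<open>Words of a given content\<close>

definition content_mset :: "nat list \<Rightarrow> nat multiset" where
  "content_mset ns = (\<Sum>k<length ns. replicate_mset (ns ! k) k)"

text \<open>These words index the rows and columns of the matrix block belonging to
  \<open>ns\<close>.\<close>

definition words :: "nat list \<Rightarrow> nat list set" where
  "words ns = {w. mset w = content_mset ns}"

definition composition_of :: "nat \<Rightarrow> nat list \<Rightarrow> nat list" where
  "composition_of c w = map (count (mset w)) [0..<c + 1]"

lemma count_content_mset: "count (content_mset ns) k = (if k < length ns then ns ! k else 0)"
  by (simp add: content_mset_def count_sum if_distrib sum.delta cong: if_cong)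

lemma set_content_mset: "set_mset (content_mset ns) \<subseteq> {..<length ns}"
proof
  fix k assume "k \<in># content_mset ns"
  then have "count (content_mset ns) k \<noteq> 0" by simp
  then show "k \<in> {..<length ns}" unfolding count_content_mset by (simp split: if_splits)
qed

lemma size_content_mset: "size (content_mset ns) = sum_list ns"
proof -
  have "size (content_mset ns) = (\<Sum>k<length ns. count (content_mset ns) k)"
    unfolding size_multiset_overloaded_eq
    by (rule sum.mono_neutral_left) (use set_content_mset in \<open>auto simp: not_in_iff\<close>)
  then show ?thesis
    by (simp add: count_content_mset sum_list_sum_nth atLeast0LessThan)
qed

text \<open>The words are the permutations of a multiset, whose number has a product of factorials
  over the occurring letters as denominator. The product extends to all
  \<open>k < length ns\<close>, since absent letters contribute \<open>fact 0 = 1\<close>.\<close>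

lemma card_words: "card (words ns) = multinomial ns"
proof -
  have "(\<Prod>k\<in>set_mset (content_mset ns). fact (count (content_mset ns) k))
      = (\<Prod>k<length ns. fact (count (content_mset ns) k) :: nat)"
    by (rule prod.mono_neutral_left) (use set_content_mset in \<open>auto simp: not_in_iff\<close>)
  also have "\<dots> = prod_list (map fact ns)"
    by (simp add: count_content_mset prod.list_conv_set_nth atLeast0LessThan)
  finally show ?thesis
    using card_permutations_of_multiset(1)[of "content_mset ns"]
    by (simp add: words_def multinomial_def size_content_mset permutations_of_multiset_def)
qed

lemma words_mset: "v \<in> words ns \<Longrightarrow> w \<in> words ns \<longleftrightarrow> mset v = mset w"
  by (auto simp: words_def)

lemma finite_words [simp]: "finite (words ns)"
  using finite_permutations_of_multiset[of "content_mset ns"]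
  by (simp add: words_def permutations_of_multiset_def)

text \<open>Together with \<open>composition_of\<close>, this puts every word of length
  \<open>n\<close> over the letters \<open>0\<close> to \<open>c\<close> into exactly one
  block.\<close>

lemma words_weak_composition:
  assumes "ns \<in> weak_compositions n (c + 1)" "w \<in> words ns"
  shows "length w = n" and "set w \<subseteq> {..c}" and "composition_of c w = ns"
proof -
  have w: "mset w = content_mset ns" and ns: "length ns = c + 1" "sum_list ns = n"
    using assms by (simp_all add: words_def weak_compositions_def)
  show "length w = n" using w ns size_content_mset by (metis size_mset)
  have "set w \<subseteq> {..<length ns}" using set_content_mset w by (metis set_mset_mset)
  then show "set w \<subseteq> {..c}" using ns by auto
  show "composition_of c w = ns"
    unfolding composition_of_def w by (rule nth_equalityI) (simp_all add: ns count_content_mset del: upt_Suc)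
qed

lemma composition_of:
  assumes "length w = n" "set w \<subseteq> {..c}"
  shows "composition_of c w \<in> weak_compositions n (c + 1)" and "w \<in> words (composition_of c w)"
proof -
  have "count (mset w) k = 0" if "k > c" for k
    using assms(2) that by (auto simp: count_eq_zero_iff)
  then have *: "mset w = content_mset (composition_of c w)"
    by (intro multiset_eqI) (auto simp: count_content_mset composition_of_def simp del: upt_Suc)
  then show "w \<in> words (composition_of c w)" by (simp add: words_def)
  have "sum_list (composition_of c w) = n"
    using * assms(1) size_content_mset by (metis size_mset)
  then show "composition_of c w \<in> weak_compositions n (c + 1)"
    by (simp add: weak_compositions_def) (simp add: composition_of_def)
qed

section \<open>The zeta transform\<close>

definition zeta :: "nat \<Rightarrow> nat \<Rightarrow> (diagram \<Rightarrow> complex) \<Rightarrow> diagram \<Rightarrow> complex" where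
  "zeta n c f d = sum f {p \<in> diagrams n c. d \<subseteq> p}"

text \<open>The sign is the Moebius function of the Boolean interval from \<open>d\<close> to
  \<open>e\<close>. The default value 0 keeps the result in
  \<open>diagram_space n c\<close>.\<close>

definition moebius :: "nat \<Rightarrow> nat \<Rightarrow> (diagram \<Rightarrow> complex) \<Rightarrow> diagram \<Rightarrow> complex" where
  "moebius n c g d = (if d \<in> diagrams n c
     then \<Sum>e \<in> {e \<in> diagrams n c. d \<subseteq> e}. (- 1) ^ card (e - d) * g e else 0)"

section \<open>Moebius inversion over sub-diagrams\<close>

lemma sum_Pow_alternating:
  assumes "finite A"
  shows "(\<Sum>S\<in>Pow A. (- 1) ^ card S) = (if A = {} then 1 else (0 :: 'a :: comm_ring_1))"
  using assms
proof (induction rule: finite_induct)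
  case (insert a A)
  \<comment> \<open>Subsets with and without \<open>a\<close> pair off with opposite signs, so the
    total is 0.\<close>
  have "(\<Sum>S\<in>insert a ` Pow A. (- 1) ^ card S) = (\<Sum>S\<in>Pow A. (- 1) ^ card (insert a S) :: 'a)"
    using insert.hyps by (subst sum.reindex) (auto simp: inj_on_def insert_eq_iff)
  also have "\<dots> = (\<Sum>S\<in>Pow A. - ((- 1) ^ card S))"
  proof (rule sum.cong[OF refl])
    fix S assume "S \<in> Pow A"
    then have "finite S" "a \<notin> S" using insert.hyps finite_subset by auto
    then show "(- 1) ^ card (insert a S) = - ((- 1) ^ card S :: 'a)" by simp
  qed
  also have "\<dots> = - (\<Sum>S\<in>Pow A. (- 1) ^ card S)" by (rule sum_negf)
  finally show ?case
    using insert.hyps unfolding Pow_insert by (subst sum.union_disjoint) auto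
qed simp

lemma sum_interval_alternating:
  assumes "finite e" "d \<subseteq> e"
  shows "(\<Sum>p\<in>{p. d \<subseteq> p \<and> p \<subseteq> e}. (- 1) ^ card (e - p)) = (if d = e then 1 else (0 :: complex))"
proof -
  have "(\<Sum>p\<in>{p. d \<subseteq> p \<and> p \<subseteq> e}. (- 1) ^ card (e - p)) = (\<Sum>S\<in>Pow (e - d). (- 1 :: complex) ^ card S)"
    by (rule sum.reindex_bij_witness[of _ "\<lambda>S. e - S" "\<lambda>p. e - p"]) (use assms(2) in auto)
  also have "\<dots> = (if e - d = {} then 1 else 0)"
    using assms(1) by (intro sum_Pow_alternating) simp
  also have "e - d = {} \<longleftrightarrow> d = e" using assms(2) by blast
  finally show ?thesis .
qed

text \<open>After exchanging the sums, the coefficient of \<open>g e\<close> is an alternating sum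
  over the interval from \<open>d\<close> to \<open>e\<close>, which vanishes unless
  \<open>e = d\<close>.\<close>

lemma zeta_moebius:
  assumes d: "d \<in> diagrams n c"
  shows "zeta n c (moebius n c g) d = g d"
proof -
  let ?S = "diagrams n c"
  have "zeta n c (moebius n c g) d =
      (\<Sum>p\<in>{p \<in> ?S. d \<subseteq> p}. \<Sum>e\<in>{e \<in> ?S. p \<subseteq> e}. (- 1) ^ card (e - p) * g e)"
    unfolding zeta_def by (rule sum.cong) (auto simp: moebius_def)
  \<comment> \<open>Zero terms make the range of \<open>e\<close> independent of \<open>p\<close>,
    so that the sums can be exchanged.\<close>
  also have "\<dots> = (\<Sum>p\<in>{p \<in> ?S. d \<subseteq> p}. \<Sum>e\<in>{e \<in> ?S. d \<subseteq> e}.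
      if p \<subseteq> e then (- 1) ^ card (e - p) * g e else 0)"
  proof (rule sum.cong[OF refl])
    fix p assume "p \<in> {p \<in> ?S. d \<subseteq> p}"
    then have *: "{e \<in> ?S. p \<subseteq> e} = {e \<in> {e \<in> ?S. d \<subseteq> e}. p \<subseteq> e}" by blast
    show "(\<Sum>e\<in>{e \<in> ?S. p \<subseteq> e}. (- 1) ^ card (e - p) * g e) = (\<Sum>e\<in>{e \<in> ?S. d \<subseteq> e}.
      if p \<subseteq> e then (- 1) ^ card (e - p) * g e else 0)"
      unfolding * by (rule sum.inter_filter) simp
  qed
  also have "\<dots> = (\<Sum>e\<in>{e \<in> ?S. d \<subseteq> e}. \<Sum>p\<in>{p \<in> ?S. d \<subseteq> p}.
      if p \<subseteq> e then (- 1) ^ card (e - p) * g e else 0)"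
    by (rule sum.swap)
  also have "\<dots> = (\<Sum>e\<in>{e \<in> ?S. d \<subseteq> e}. if d = e then g e else 0)"
  proof (rule sum.cong[OF refl])
    fix e assume "e \<in> {e \<in> ?S. d \<subseteq> e}"
    then have e: "e \<in> ?S" "d \<subseteq> e" by auto
    have "(\<Sum>p\<in>{p \<in> ?S. d \<subseteq> p}. if p \<subseteq> e then (- 1) ^ card (e - p) * g e else 0)
        = (\<Sum>p\<in>{p \<in> {p \<in> ?S. d \<subseteq> p}. p \<subseteq> e}. (- 1) ^ card (e - p) * g e)"
      by (rule sum.inter_filter[symmetric]) simp
    \<comment> \<open>Every set between \<open>d\<close> and \<open>e\<close> is a diagram, so
      nothing is missing from the Boolean interval.\<close>
    also have "{p \<in> {p \<in> ?S. d \<subseteq> p}. p \<subseteq> e} = {p. d \<subseteq> p \<and> p \<subseteq> e}"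
      using diagrams_subset[OF e(1)] by blast
    also have "(\<Sum>p\<in>\<dots>. (- 1) ^ card (e - p) * g e) = (if d = e then 1 else 0) * g e"
      by (simp only: sum_distrib_right[symmetric] sum_interval_alternating[OF finite_diagram[OF e(1)] e(2)])
    finally show "(\<Sum>p\<in>{p \<in> ?S. d \<subseteq> p}. if p \<subseteq> e then (- 1) ^ card (e - p) * g e else 0)
        = (if d = e then g e else 0)" by simp
  qed
  also have "\<dots> = g d" using d by (simp add: sum.delta')
  finally show ?thesis .
qed

text \<open>At a maximal diagram where \<open>f\<close> and \<open>g\<close> differ, all strictly
  larger terms of the two sums agree, so the transforms would differ there.\<close>

lemma zeta_inj:
  assumes fg: "f \<in> diagram_space n c" "g \<in> diagram_space n c"
    and eq: "\<And>d. d \<in> diagrams n c \<Longrightarrow> zeta n c f d = zeta n c g d"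
  shows "f = g"
proof (rule ccontr)
  assume "f \<noteq> g"
  then obtain d where "f d \<noteq> g d" by blast
  then have "d \<in> {d \<in> diagrams n c. f d \<noteq> g d}" using fg unfolding diagram_space_def by force
  then obtain m where m: "m \<in> diagrams n c" "f m \<noteq> g m"
    and max: "\<And>p. p \<in> diagrams n c \<Longrightarrow> f p \<noteq> g p \<Longrightarrow> m \<subseteq> p \<Longrightarrow> m = p"
    using finite_has_maximal[of "{d \<in> diagrams n c. f d \<noteq> g d}"] by auto
  have *: "zeta n c h m = h m + sum h {p \<in> diagrams n c. m \<subset> p}" for h
  proof -
    have "{p \<in> diagrams n c. m \<subseteq> p} = insert m {p \<in> diagrams n c. m \<subset> p}" using m(1) by blast
    then show ?thesis unfolding zeta_def by simp
  qed
  have "sum f {p \<in> diagrams n c. m \<subset> p} = sum g {p \<in> diagrams n c. m \<subset> p}"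
    by (rule sum.cong) (use max in auto)
  with eq[OF m(1)] * m(2) show False by simp
qed

section \<open>The zeta transform of a product\<close>

text \<open>Existence and uniqueness of the middle word split the pairs whose product contains the
  diagram of \<open>v\<close>, \<open>w\<close> into disjoint rectangles, one for each
  \<open>u\<close>. The sum over a rectangle factors.\<close>

lemma zeta_convolution:
  assumes ns: "ns \<in> weak_compositions n (c + 1)" and v: "v \<in> words ns" and w: "w \<in> words ns"
  shows "zeta n c (convolution n c f g) (word_diagram v w) =
    (\<Sum>u\<in>words ns. zeta n c f (word_diagram v u) * zeta n c g (word_diagram u w))"
proof -
  let ?S = "diagrams n c"
  let ?d = "word_diagram v w"
  let ?P = "{(p, q) \<in> ?S \<times> ?S. ?d \<subseteq> diagram_mult p q}"
  let ?A = "\<lambda>u. {p \<in> ?S. word_diagram v u \<subseteq> p}" and ?B = "\<lambda>u. {q \<in> ?S. word_diagram u w \<subseteq> q}"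
  note V = words_weak_composition(1,2)[OF ns v]
  have vw: "mset v = mset w" using v w by (simp add: words_def)
  have fin: "finite ?P" by (rule finite_subset[of _ "?S \<times> ?S"]) auto
  have "zeta n c (convolution n c f g) ?d =
      (\<Sum>r\<in>{r \<in> ?S. ?d \<subseteq> r}. \<Sum>x\<in>{x \<in> ?P. (case x of (p, q) \<Rightarrow> diagram_mult p q) = r}.
        case x of (p, q) \<Rightarrow> f p * g q)"
    unfolding zeta_def convolution_def by (intro sum.cong) auto
  \<comment> \<open>Each pair is counted under exactly one \<open>r\<close>, namely its
    product.\<close>
  also have "\<dots> = (\<Sum>(p, q)\<in>?P. f p * g q)"
    by (rule sum.group[OF fin]) (auto intro: diagram_mult_closed)
  also have "?P = (\<Union>u\<in>words ns. ?A u \<times> ?B u)"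
  proof (intro equalityI subsetI)
    fix x assume "x \<in> ?P"
    then obtain p q where x: "x = (p, q)" "p \<in> ?S" "q \<in> ?S" "?d \<subseteq> diagram_mult p q" by auto
    obtain u where "mset v = mset u" "word_diagram v u \<subseteq> p" "word_diagram u w \<subseteq> q"
      by (rule middle_word_exists[OF x(2,3) vw V x(4)])
    with x words_mset[OF v] show "x \<in> (\<Union>u\<in>words ns. ?A u \<times> ?B u)" by auto
  next
    fix x assume "x \<in> (\<Union>u\<in>words ns. ?A u \<times> ?B u)"
    then obtain p q u where x: "x = (p, q)" "p \<in> ?S" "q \<in> ?S" "u \<in> words ns"
      "word_diagram v u \<subseteq> p" "word_diagram u w \<subseteq> q" by auto
    have "?d = diagram_mult (word_diagram v u) (word_diagram u w)"
      using words_mset[OF v, of u] x(4) by (simp add: word_diagram_mult)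
    also have "\<dots> \<subseteq> diagram_mult p q"
      using x(5,6) unfolding diagram_mult_def by blast
    finally show "x \<in> ?P" using x by simp
  qed
  also have "(\<Sum>(p, q)\<in>\<dots>. f p * g q) = (\<Sum>u\<in>words ns. \<Sum>(p, q)\<in>?A u \<times> ?B u. f p * g q)"
  proof (rule sum.UNION_disjoint)
    show "\<forall>u\<in>words ns. \<forall>u'\<in>words ns. u \<noteq> u' \<longrightarrow> (?A u \<times> ?B u) \<inter> (?A u' \<times> ?B u') = {}"
    proof (intro ballI impI)
      fix u u' assume u: "u \<in> words ns" "u' \<in> words ns" "u \<noteq> u'"
      have "?A u \<inter> ?A u' = {}"
        using middle_word_unique[of _ n c v u u'] u words_mset[OF v] by auto
      then show "(?A u \<times> ?B u) \<inter> (?A u' \<times> ?B u') = {}" by blast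
    qed
  qed auto
  also have "\<dots> = (\<Sum>u\<in>words ns. zeta n c f (word_diagram v u) * zeta n c g (word_diagram u w))"
    unfolding zeta_def sum_product sum.cartesian_product ..
  finally show ?thesis .
qed

section \<open>The map into the matrix blocks\<close>

lemma zeta_add: "zeta n c (\<lambda>d. f d + g d) d = zeta n c f d + zeta n c g d"
  by (simp add: zeta_def sum.distrib)

lemma zeta_smult: "zeta n c (\<lambda>d. a * f d) d = a * zeta n c f d"
  by (simp add: zeta_def sum_distrib_left)

text \<open>Matrix entries are indexed by numbers, so some enumeration of the words is fixed; which
  one does not matter.\<close>

definition nth_word :: "nat list \<Rightarrow> nat \<Rightarrow> nat list" where
  "nth_word ns = (SOME h. bij_betw h {0..<multinomial ns} (words ns))"

lemma bij_nth_word: "bij_betw (nth_word ns) {0..<multinomial ns} (words ns)"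
proof -
  have "\<exists>h. bij_betw h {0..<multinomial ns} (words ns)"
    using ex_bij_betw_nat_finite[OF finite_words[of ns]] unfolding card_words .
  then show ?thesis unfolding nth_word_def by (rule someI_ex)
qed

lemma nth_word_in: "i < multinomial ns \<Longrightarrow> nth_word ns i \<in> words ns"
  using bij_betwE[OF bij_nth_word] by auto

definition transform ::
    "nat \<Rightarrow> nat \<Rightarrow> (diagram \<Rightarrow> complex) \<Rightarrow> nat list \<Rightarrow> complex mat" where
  "transform n c f = (\<lambda>ns\<in>weak_compositions n (c + 1).
     mat (multinomial ns) (multinomial ns)
       (\<lambda>(i, j). zeta n c f (word_diagram (nth_word ns i) (nth_word ns j))))"

abbreviation (input) matrix_sum :: "nat \<Rightarrow> nat \<Rightarrow> (complex, nat list \<Rightarrow> complex mat) module" where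
  "matrix_sum n c \<equiv>
     direct_sum_algebra (weak_compositions n (c + 1)) (\<lambda>ns. mat_algebra (multinomial ns))"

lemma complex_algebra_matrix_sum: "complex_algebra (matrix_sum n c)"
  by (rule complex_algebra_direct_sum) (rule complex_algebra_mat)

lemma transform_add: "transform n c (\<lambda>d. f d + g d) = transform n c f \<oplus>\<^bsub>matrix_sum n c\<^esub> transform n c g"
  unfolding transform_def direct_sum_algebra_simps module_mat_simps
  by (rule restrict_ext) (auto simp: zeta_add intro!: eq_matI)

lemma transform_smult: "transform n c (\<lambda>d. a * f d) = a \<odot>\<^bsub>matrix_sum n c\<^esub> transform n c f"
  unfolding transform_def direct_sum_algebra_simps module_mat_simps
  by (rule restrict_ext) (auto simp: zeta_smult intro!: eq_matI)

lemma transform_zero: "transform n c (\<lambda>d. 0) = \<zero>\<^bsub>matrix_sum n c\<^esub>"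
  unfolding transform_def direct_sum_algebra_simps module_mat_simps
  by (rule restrict_ext) (auto simp: zeta_def intro!: eq_matI)

lemma transform_convolution:
  "transform n c (convolution n c f g) = transform n c f \<otimes>\<^bsub>matrix_sum n c\<^esub> transform n c g"
  unfolding transform_def direct_sum_algebra_simps module_mat_simps
proof (rule restrict_ext)
  fix ns assume ns: "ns \<in> weak_compositions n (c + 1)"
  let ?m = "multinomial ns"
  let ?Z = "\<lambda>f. mat ?m ?m (\<lambda>(i, j). zeta n c f (word_diagram (nth_word ns i) (nth_word ns j)))"
  have "?Z (convolution n c f g) = ?Z f * ?Z g"
  proof (rule eq_matI)
    fix i j assume "i < dim_row (?Z f * ?Z g)" "j < dim_col (?Z f * ?Z g)"
    then have ij: "i < ?m" "j < ?m" by simp_all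
    have "?Z (convolution n c f g) $$ (i, j) =
        (\<Sum>u\<in>words ns. zeta n c f (word_diagram (nth_word ns i) u) * zeta n c g (word_diagram u (nth_word ns j)))"
      using ij by (simp add: zeta_convolution[OF ns nth_word_in nth_word_in])
    \<comment> \<open>The enumeration turns the sum over middle words into the row-by-column sum of
      the matrix product.\<close>
    also have "\<dots> = (\<Sum>l\<in>{0..<?m}. zeta n c f (word_diagram (nth_word ns i) (nth_word ns l)) *
        zeta n c g (word_diagram (nth_word ns l) (nth_word ns j)))"
      by (rule sum.reindex_bij_betw[OF bij_nth_word, symmetric])
    also have "\<dots> = (?Z f * ?Z g) $$ (i, j)"
      using ij by (simp add: scalar_prod_def)
    finally show "?Z (convolution n c f g) $$ (i, j) = (?Z f * ?Z g) $$ (i, j)" .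
  qed simp_all
  then show "?Z (convolution n c f g) =
      (\<lambda>ns\<in>weak_compositions n (c + 1). mat (multinomial ns) (multinomial ns)
        (\<lambda>(i, j). zeta n c f (word_diagram (nth_word ns i) (nth_word ns j)))) ns *
      (\<lambda>ns\<in>weak_compositions n (c + 1). mat (multinomial ns) (multinomial ns)
        (\<lambda>(i, j). zeta n c g (word_diagram (nth_word ns i) (nth_word ns j)))) ns"
    using ns by simp
qed

lemma transform_carrier: "transform n c f \<in> carrier (matrix_sum n c)"
  unfolding transform_def direct_sum_algebra_simps module_mat_simps by auto

text \<open>Diagrams correspond to pairs of words of equal content, so the entries of all blocks
  together are the values of the zeta transform, each diagram occurring once. Bijectivity is then
  Moebius inversion.\<close>

lemma bij_transform: "bij_betw (transform n c) (diagram_space n c) (carrier (matrix_sum n c))"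
proof (rule bij_betw_imageI)
  show "inj_on (transform n c) (diagram_space n c)"
  proof (rule inj_onI)
    fix f g assume fg: "f \<in> diagram_space n c" "g \<in> diagram_space n c"
      and eq: "transform n c f = transform n c g"
    show "f = g"
    proof (rule zeta_inj[OF fg])
      fix d assume d: "d \<in> diagrams n c"
      \<comment> \<open>As \<open>d\<close> is the diagram of its two words, its zeta value is an
        entry of the block of their common content.\<close>
      define ns where "ns = composition_of c (top_word n d)"
      have ns: "ns \<in> weak_compositions n (c + 1)" and v: "top_word n d \<in> words ns"
        using composition_of[OF length_top_word set_top_word[OF d]] by (simp_all add: ns_def)
      have w: "bottom_word n d \<in> words ns"
        using words_mset[OF v] mset_top_bottom_word[OF d] by simp
      note surj = bij_betw_imp_surj_on[OF bij_nth_word[of ns], symmetric]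
      obtain i where i: "i < multinomial ns" "top_word n d = nth_word ns i"
        using v unfolding surj by auto
      obtain j where j: "j < multinomial ns" "bottom_word n d = nth_word ns j"
        using w unfolding surj by auto
      have "transform n c f ns $$ (i, j) = transform n c g ns $$ (i, j)" by (simp only: eq)
      with ns i j(1) show "zeta n c f d = zeta n c g d"
        by (simp add: transform_def word_diagram_top_bottom[OF d] flip: i(2) j(2))
    qed
  qed
  show "transform n c ` diagram_space n c = carrier (matrix_sum n c)"
  proof (intro equalityI subsetI)
    fix x assume x: "x \<in> carrier (matrix_sum n c)"
    define idx where "idx ns = inv_into {0..<multinomial ns} (nth_word ns)" for ns
    \<comment> \<open>The entries of \<open>x\<close> read as a function on diagrams, with the top
      word as row and the bottom word as column; \<open>moebius\<close> turns it into the preimage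
      of \<open>x\<close>. Its values outside \<open>diagrams n c\<close> do not enter
      there.\<close>
    define g where "g d = x (composition_of c (top_word n d)) $$
      (idx (composition_of c (top_word n d)) (top_word n d),
       idx (composition_of c (top_word n d)) (bottom_word n d))" for d
    have idx: "idx ns (nth_word ns i) = i" if "i < multinomial ns" for ns i
      unfolding idx_def by (rule inv_into_f_f[OF bij_betw_imp_inj_on[OF bij_nth_word]]) (use that in simp)
    have "transform n c (moebius n c g) = x"
    proof (rule PiE_ext)
      show "transform n c (moebius n c g) \<in> (\<Pi>\<^sub>E ns\<in>weak_compositions n (c + 1).
          carrier (mat_algebra (multinomial ns)))"
        using transform_carrier by (simp add: direct_sum_algebra_simps)
      show "x \<in> (\<Pi>\<^sub>E ns\<in>weak_compositions n (c + 1). carrier (mat_algebra (multinomial ns)))"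
        using x by (simp add: direct_sum_algebra_simps)
      then have dim: "x ns \<in> carrier_mat (multinomial ns) (multinomial ns)"
        if "ns \<in> weak_compositions n (c + 1)" for ns
        using PiE_mem[OF _ that] by (fastforce simp: module_mat_simps)
      fix ns assume ns: "ns \<in> weak_compositions n (c + 1)"
      show "transform n c (moebius n c g) ns = x ns"
      proof (rule eq_matI)
        fix i j assume "i < dim_row (x ns)" "j < dim_col (x ns)"
        with dim[OF ns] have ij: "i < multinomial ns" "j < multinomial ns" by auto
        let ?v = "nth_word ns i" and ?w = "nth_word ns j"
        note v = nth_word_in[OF ij(1)] and w = nth_word_in[OF ij(2)]
        note V = words_weak_composition[OF ns v]
        have vw: "mset ?v = mset ?w" using v w by (simp add: words_def)
        note props = vw V(1,2)
        have "transform n c (moebius n c g) ns $$ (i, j) = g (word_diagram ?v ?w)"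
          using ns ij by (simp add: transform_def zeta_moebius[OF word_diagram_in_diagrams[OF props]])
        also have "\<dots> = x ns $$ (i, j)"
          by (simp add: g_def top_word_word_diagram[OF props] bottom_word_word_diagram[OF props]
              V(3) idx ij)
        finally show "transform n c (moebius n c g) ns $$ (i, j) = x ns $$ (i, j)" .
      qed (use dim[OF ns] ns in \<open>auto simp: transform_def\<close>)
    qed
    moreover have "moebius n c g \<in> diagram_space n c"
      by (simp add: diagram_space_def moebius_def)
    ultimately show "x \<in> transform n c ` diagram_space n c" by blast
  qed (use transform_carrier in blast)
qed

section \<open>Closure under the product and the identity element\<close>

lemma convolution_closed: "convolution n c f g \<in> diagram_space n c"
proof -
  have "convolution n c f g d = 0" if "d \<notin> diagrams n c" for d
  proof -
    have "{(p, q) \<in> diagrams n c \<times> diagrams n c. diagram_mult p q = d} = {}"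
      using that diagram_mult_closed by blast
    then show ?thesis by (simp only: convolution_def sum.empty)
  qed
  then show ?thesis by (simp add: diagram_space_def)
qed

text \<open>The preimage of the identity family is a two-sided unit, because the map is
  multiplicative and injective. Two-sided units are unique, so the description by \<open>THE\<close>
  denotes this preimage.\<close>

lemma diagram_algebra_one:
  "\<one>\<^bsub>diagram_algebra n c\<^esub> \<in> diagram_space n c \<and>
   transform n c \<one>\<^bsub>diagram_algebra n c\<^esub> = \<one>\<^bsub>matrix_sum n c\<^esub>"
proof -
  let ?V = "diagram_space n c" and ?h = "transform n c" and ?B = "matrix_sum n c"
  note B = complex_algebra_matrix_sum[of n c]
  have "\<one>\<^bsub>?B\<^esub> \<in> ?h ` ?V"
    using complex_algebra_closed(2)[OF B] bij_betw_imp_surj_on[OF bij_transform] by blast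
  then obtain e where e: "e \<in> ?V" "?h e = \<one>\<^bsub>?B\<^esub>" by auto
  have unit: "convolution n c e f = f \<and> convolution n c f e = f" if f: "f \<in> ?V" for f
  proof -
    have "?h (convolution n c e f) = ?h f" "?h (convolution n c f e) = ?h f"
      unfolding transform_convolution e(2)
      by (rule complex_algebra_laws(5,6)[OF B transform_carrier])+
    then show ?thesis
      using inj_onD[OF bij_betw_imp_inj_on[OF bij_transform]] convolution_closed f by blast
  qed
  have "(THE e. e \<in> ?V \<and> (\<forall>f \<in> ?V. convolution n c e f = f \<and> convolution n c f e = f)) = e"
  proof (rule the_equality)
    show "e \<in> ?V \<and> (\<forall>f \<in> ?V. convolution n c e f = f \<and> convolution n c f e = f)"
      using e(1) unit by blast
    fix e' assume "e' \<in> ?V \<and> (\<forall>f \<in> ?V. convolution n c e' f = f \<and> convolution n c f e' = f)"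
    then show "e' = e" using unit[of e'] e(1) by metis
  qed
  then show ?thesis using e by (simp add: diagram_algebra_def)
qed

theorem theorem3p10:
  fixes c n :: nat
  assumes "c \<ge> 1"
  shows "algebra_isomorphic (diagram_algebra n c)
    (direct_sum_algebra (weak_compositions n (c + 1)) (\<lambda>ns. mat_algebra (multinomial ns)))"
proof (rule algebra_isomorphicI[OF complex_algebra_matrix_sum])
  let ?A = "diagram_algebra n c"
  have A: "carrier ?A = diagram_space n c" "\<zero>\<^bsub>?A\<^esub> = (\<lambda>d. 0)"
    "\<And>f g. f \<otimes>\<^bsub>?A\<^esub> g = convolution n c f g" "\<And>f g. f \<oplus>\<^bsub>?A\<^esub> g = (\<lambda>d. f d + g d)"
    "\<And>a f. a \<odot>\<^bsub>?A\<^esub> f = (\<lambda>d. a * f d)"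
    by (simp_all add: diagram_algebra_def)
  show "bij_betw (transform n c) (carrier ?A) (carrier (matrix_sum n c))"
    unfolding A by (rule bij_transform)
  show "\<zero>\<^bsub>?A\<^esub> \<in> carrier ?A" "transform n c \<zero>\<^bsub>?A\<^esub> = \<zero>\<^bsub>matrix_sum n c\<^esub>"
    unfolding A transform_zero by (simp_all add: diagram_space_def)
  show "\<one>\<^bsub>?A\<^esub> \<in> carrier ?A" "transform n c \<one>\<^bsub>?A\<^esub> = \<one>\<^bsub>matrix_sum n c\<^esub>"
    using diagram_algebra_one[of n c] by (simp_all add: A)
  fix f g assume fg: "f \<in> carrier ?A" "g \<in> carrier ?A"
  show "f \<oplus>\<^bsub>?A\<^esub> g \<in> carrier ?A \<and>
      transform n c (f \<oplus>\<^bsub>?A\<^esub> g) = transform n c f \<oplus>\<^bsub>matrix_sum n c\<^esub> transform n c g"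
    using fg unfolding A transform_add by (simp add: diagram_space_def)
  show "f \<otimes>\<^bsub>?A\<^esub> g \<in> carrier ?A \<and>
      transform n c (f \<otimes>\<^bsub>?A\<^esub> g) = transform n c f \<otimes>\<^bsub>matrix_sum n c\<^esub> transform n c g"
    unfolding A transform_convolution by (simp add: convolution_closed)
next
  fix a f assume "f \<in> carrier (diagram_algebra n c)"
  then show "a \<odot>\<^bsub>diagram_algebra n c\<^esub> f \<in> carrier (diagram_algebra n c) \<and>
      transform n c (a \<odot>\<^bsub>diagram_algebra n c\<^esub> f) = a \<odot>\<^bsub>matrix_sum n c\<^esub> transform n c f"
    using transform_smult[of n c a f] by (simp add: diagram_algebra_def diagram_space_def)
qed

end
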